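(* (i) Let $k_1,\dots,k_z$ be non-negative integers and let $\rho_1,\rho_2\in(-1,1)$. The matrices $\boldsymbol{\Sigma}_{\rho_1,\rho_2}^{[k_1,1]},\dots,\boldsymbol{\Sigma}_{\rho_1,\rho_2}^{[k_z,1]}$ are all positive definite if and only if $$L_{\rho_1,1}\left(\max\{k_1,\dots,k_z\}\right)<\rho_2<1.$$ (ii) If real numbers $\rho_1,\rho_2$ satisfy $\rho_1^2<\rho_2<1$, then $\boldsymbol{\Sigma}_{\rho_1,\rho_2}^{[k,1]}$ is positive definite for every non-negative integer $k$.
   Context: For a positive integer $k$, $\boldsymbol{\Sigma}_{\rho_2}^{[k,1]}$ is the $k\times k$ matrix with all diagonal entries equal to $1$ and all off-diagonal entries equal to $\rho_2$. For a non-negative integer $k$, $$\boldsymbol{\Sigma}_{\rho_1,\rho_2}^{[k,1]}=\begin{pmatrix}1&\rho_1\mathbf{1}_k^{\mathrm T}\\ \rho_1\mathbf{1}_k&\boldsymbol{\Sigma}_{\rho_2}^{[k,1]}\end{pmatrix}\ (k\ge1),\qquad \boldsymbol{\Sigma}_{\rho_1,\rho_2}^{[0,1]}=1,$$ where $\mathbf{1}_k$ is the column vector of ones of length $k$. For $\rho_1\in(-1,1)$ and a non-negative integer $k$, $$L_{\rho_1,1}(k)=\begin{cases}\dfrac{k\rho_1^2-1}{k-1},&k>1,\\-1,&\text{otherwise.}\end{cases}$$ *)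

theory Defs
  imports Complex_Main "Jordan_Normal_Form.Matrix"
begin

text \<open>Symmetry is part of positive definiteness here; it also forces the matrix to be square.\<close>

definition positive_definite_mat :: "real mat \<Rightarrow> bool" where
  "positive_definite_mat A \<longleftrightarrow>
     transpose_mat A = A \<and>
     (\<forall>x \<in> carrier_vec (dim_row A). x \<noteq> 0\<^sub>v (dim_row A) \<longrightarrow> x \<bullet> (A *\<^sub>v x) > 0)"

definition equicorr_mat :: "real \<Rightarrow> nat \<Rightarrow> real mat" where
  "equicorr_mat \<rho>2 k = mat k k (\<lambda>(i, j). if i = j then 1 else \<rho>2)"

definition bordered_equicorr_mat :: "real \<Rightarrow> real \<Rightarrow> nat \<Rightarrow> real mat" where
  "bordered_equicorr_mat \<rho>1 \<rho>2 k =
     (if k = 0 then 1\<^sub>m 1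
      else four_block_mat
             (1\<^sub>m 1)                          (\<rho>1 \<cdot>\<^sub>m mat 1 k (\<lambda>_. 1))
             (\<rho>1 \<cdot>\<^sub>m mat k 1 (\<lambda>_. 1))  (equicorr_mat \<rho>2 k))"

definition lower_corr_bound :: "real \<Rightarrow> nat \<Rightarrow> real" where
  "lower_corr_bound \<rho>1 k = (if k > 1 then (real k * \<rho>1\<^sup>2 - 1) / (real k - 1) else -1)"

end

theory Submission
  imports Defs "HOL-Analysis.Convex"
begin

text \<open>Writing a vector as \<open>(x\<^sub>0, y)\<close> with \<open>S = \<Sum>y\<^sub>i\<close> and \<open>Q = \<Sum>y\<^sub>i\<^sup>2\<close>, completing the square turns the
  quadratic form into \<open>(x\<^sub>0 + \<rho>\<^sub>1 S)\<^sup>2 + (1 - \<rho>\<^sub>2) Q + (\<rho>\<^sub>2 - \<rho>\<^sub>1\<^sup>2) S\<^sup>2\<close>. Since \<open>0 \<le> S\<^sup>2 \<le> k Q\<close>, with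
  equality on the right for \<open>y = (1, \<dots>, 1)\<close>, for \<open>\<rho>\<^sub>2 < 1\<close> it is positive definite iff
  \<open>1 - \<rho>\<^sub>2 + k (\<rho>\<^sub>2 - \<rho>\<^sub>1\<^sup>2) > 0\<close>. This is affine in \<open>k\<close> and positive at \<open>k = 0\<close>, so it holds for
  all \<open>k\<^sub>i\<close> iff it holds for their maximum.\<close>

text \<open>One entry function replaces the blocks and also covers \<open>k = 0\<close>, so later
  sums need no case split.\<close>

lemma bordered_equicorr_mat_eq:
  "bordered_equicorr_mat \<rho>1 \<rho>2 k =
     mat (Suc k) (Suc k) (\<lambda>(i, j). if i = j then 1 else if i = 0 \<or> j = 0 then \<rho>1 else \<rho>2)"
  by (rule eq_matI) (auto simp: bordered_equicorr_mat_def equicorr_mat_def)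

lemma bordered_equicorr_quadratic_form:
  fixes x :: "real vec"
  assumes "x \<in> carrier_vec (Suc k)"
  defines "S \<equiv> \<Sum>i<k. x $ Suc i"
  shows "x \<bullet> (bordered_equicorr_mat \<rho>1 \<rho>2 k *\<^sub>v x) =
    (x $ 0 + \<rho>1 * S)\<^sup>2 + (1 - \<rho>2) * (\<Sum>i<k. (x $ Suc i)\<^sup>2) + (\<rho>2 - \<rho>1\<^sup>2) * S\<^sup>2"
proof -
  let ?c = "\<lambda>i j. if i = j then 1 else if i = 0 \<or> j = 0 then \<rho>1 else \<rho>2"
  \<comment> \<open>The lower block is \<open>\<rho>2\<close> times the all-ones matrix plus
    \<open>1 - \<rho>2\<close> times the identity.\<close>
  have inner: "(\<Sum>j<k. ?c (Suc i) (Suc j) * x $ Suc j) = \<rho>2 * S + (1 - \<rho>2) * x $ Suc i"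
    if "i < k" for i
  proof -
    have "(\<Sum>j<k. ?c (Suc i) (Suc j) * x $ Suc j)
        = (\<Sum>j<k. \<rho>2 * x $ Suc j + (if j = i then (1 - \<rho>2) * x $ Suc j else 0))"
      by (rule sum.cong) (auto simp: algebra_simps)
    then show ?thesis
      using that by (simp add: sum.distrib sum_distrib_left S_def)
  qed
  \<comment> \<open>The sums stay unexpanded: \<open>sum.lessThan_Suc\<close> would split off the
    last index, but index 0 is the exceptional one and is split off next.\<close>
  have "x \<bullet> (bordered_equicorr_mat \<rho>1 \<rho>2 k *\<^sub>v x) = (\<Sum>i<Suc k. x $ i * (\<Sum>j<Suc k. ?c i j * x $ j))"
    using assms(1) unfolding bordered_equicorr_mat_eq
    by (auto simp: scalar_prod_def atLeast0LessThan intro!: sum.cong simp del: sum.lessThan_Suc)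
  also have "\<dots> = x $ 0 * (x $ 0 + \<rho>1 * S)
      + (\<Sum>i<k. x $ Suc i * (\<rho>1 * x $ 0 + (\<rho>2 * S + (1 - \<rho>2) * x $ Suc i)))"
    unfolding sum.lessThan_Suc_shift
    by (intro arg_cong2[of _ _ _ _ "(+)"] sum.cong arg_cong2[of _ _ _ _ "(*)"])
       (auto simp: inner[simplified] S_def sum_distrib_left)
  also have "(\<Sum>i<k. x $ Suc i * (\<rho>1 * x $ 0 + (\<rho>2 * S + (1 - \<rho>2) * x $ Suc i)))
      = (\<rho>1 * x $ 0 + \<rho>2 * S) * S + (1 - \<rho>2) * (\<Sum>i<k. (x $ Suc i)\<^sup>2)"
    unfolding S_def sum_distrib_left sum.distrib[symmetric]
    by (rule sum.cong) (auto simp: algebra_simps power2_eq_square)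
  finally show ?thesis
    by (simp add: algebra_simps power2_eq_square)
qed

lemma positive_definite_bordered_equicorr_iff:
  assumes "\<rho>2 < 1"
  shows "positive_definite_mat (bordered_equicorr_mat \<rho>1 \<rho>2 k) \<longleftrightarrow>
    0 < 1 - \<rho>2 + real k * (\<rho>2 - \<rho>1\<^sup>2)" (is "?P \<longleftrightarrow> 0 < ?c")
proof
  have dim: "dim_row (bordered_equicorr_mat \<rho>1 \<rho>2 k) = Suc k"
    by (simp add: bordered_equicorr_mat_eq)
  show "0 < ?c" if ?P
  proof (cases "k = 0")
    case False
    \<comment> \<open>Ones below the first entry give \<open>S = k\<close> and \<open>Q = k\<close>,
      the equality case of Cauchy-Schwarz; the first entry makes the completed square
      vanish.\<close>
    define x where "x = vec (Suc k) (\<lambda>i. if i = 0 then - \<rho>1 * real k else 1)"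
    have x: "x \<in> carrier_vec (Suc k)" by (simp add: x_def)
    \<comment> \<open>Entry 0 could not show that \<open>x\<close> is nonzero, since it vanishes for
      \<open>\<rho>1 = 0\<close>; index 1 exists because \<open>k > 0\<close>.\<close>
    have "x $ 1 \<noteq> 0\<^sub>v (Suc k) $ 1" using False by (simp add: x_def)
    then have "0 < x \<bullet> (bordered_equicorr_mat \<rho>1 \<rho>2 k *\<^sub>v x)"
      using that x unfolding positive_definite_mat_def dim by metis
    also have "\<dots> = real k * ?c"
      unfolding bordered_equicorr_quadratic_form[OF x]
      by (simp add: x_def algebra_simps power2_eq_square)
    finally show ?thesis by (simp add: zero_less_mult_iff)
  qed (use assms in simp)
  show ?P if c: "0 < ?c"
    unfolding positive_definite_mat_def dim
  proof (intro conjI ballI impI)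
    show "transpose_mat (bordered_equicorr_mat \<rho>1 \<rho>2 k) = bordered_equicorr_mat \<rho>1 \<rho>2 k"
      unfolding bordered_equicorr_mat_eq by (rule eq_matI) auto
    fix x :: "real vec"
    assume x: "x \<in> carrier_vec (Suc k)" and nz: "x \<noteq> 0\<^sub>v (Suc k)"
    define S where "S = (\<Sum>i<k. x $ Suc i)"
    define Q where "Q = (\<Sum>i<k. (x $ Suc i)\<^sup>2)"
    have form: "x \<bullet> (bordered_equicorr_mat \<rho>1 \<rho>2 k *\<^sub>v x) =
        (x $ 0 + \<rho>1 * S)\<^sup>2 + ((1 - \<rho>2) * Q + (\<rho>2 - \<rho>1\<^sup>2) * S\<^sup>2)"
      using bordered_equicorr_quadratic_form[OF x] by (simp add: S_def Q_def)
    show "0 < x \<bullet> (bordered_equicorr_mat \<rho>1 \<rho>2 k *\<^sub>v x)"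
    \<comment> \<open>If \<open>Q = 0\<close>, only \<open>x $ 0\<close> can be nonzero and the
      square is positive; otherwise the remaining two terms are already positive together.\<close>
    proof (cases "Q = 0")
      case True
      then have y: "x $ Suc i = 0" if "i < k" for i
        using that by (simp add: Q_def sum_nonneg_eq_0_iff)
      then have "S = 0" by (simp add: S_def)
      moreover have "x $ 0 \<noteq> 0"
      proof
        assume "x $ 0 = 0"
        with y have "x $ i = 0" if "i < Suc k" for i
          using that by (cases i) auto
        with x have "x = 0\<^sub>v (Suc k)" by (intro eq_vecI) auto
        with nz show False ..
      qed
      ultimately show ?thesis using True by (simp add: form)
    next
      case False
      then have Q: "0 < Q"
        by (simp add: Q_def sum_nonneg order_less_le)
      have "0 < (1 - \<rho>2) * Q + (\<rho>2 - \<rho>1\<^sup>2) * S\<^sup>2"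
      \<comment> \<open>The sign of the coefficient of \<open>S\<^sup>2\<close> decides which bound
        is needed: \<open>S\<^sup>2\<close> from below by 0, or from above by
        \<open>k * Q\<close>.\<close>
      proof (cases "\<rho>2 \<ge> \<rho>1\<^sup>2")
        case True
        then show ?thesis using Q assms by (simp add: add_pos_nonneg)
      next
        case False
        have "S\<^sup>2 \<le> real k * Q"
          using sum_squared_le_sum_of_squares[of "\<lambda>i. x $ Suc i" "{..<k}"]
          by (simp add: S_def Q_def mult.commute)
        with False have "(\<rho>2 - \<rho>1\<^sup>2) * (real k * Q) \<le> (\<rho>2 - \<rho>1\<^sup>2) * S\<^sup>2"
          by (intro mult_left_mono_neg) auto
        moreover have "0 < ?c * Q" using c Q by simp
        ultimately show ?thesis by (simp add: algebra_simps)
      qed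
      then show ?thesis by (simp add: form add_nonneg_pos)
    qed
  qed
qed

text \<open>For \<open>k > 1\<close>, clear the positive denominator \<open>k - 1\<close>. For
  \<open>k = 0\<close> and \<open>k = 1\<close> both sides are true: the bound is -1, and the
  right-hand expression is \<open>1 - \<rho>2\<close> or \<open>1 - \<rho>1\<^sup>2\<close>.\<close>

lemma lower_corr_bound_less_iff:
  assumes "\<rho>1 \<in> {-1<..<1}" "\<rho>2 \<in> {-1<..<1}"
  shows "lower_corr_bound \<rho>1 k < \<rho>2 \<longleftrightarrow> 0 < 1 - \<rho>2 + real k * (\<rho>2 - \<rho>1\<^sup>2)"
proof -
  consider "k = 0" | "k = 1" | "k > 1" by linarith
  then show ?thesis
  proof cases
    case 2
    have "\<rho>1\<^sup>2 < 1" using assms(1) by (simp add: abs_square_less_1 abs_less_iff)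
    with 2 assms show ?thesis by (simp add: lower_corr_bound_def)
  next
    case 3
    then show ?thesis
      by (simp add: lower_corr_bound_def pos_divide_less_eq) (simp add: algebra_simps)
  qed (use assms in \<open>auto simp: lower_corr_bound_def\<close>)
qed

theorem corollary1:
  shows
    "(\<forall>(z::nat) (k::nat \<Rightarrow> nat) (\<rho>1::real) (\<rho>2::real).
        z \<ge> 1 \<longrightarrow> \<rho>1 \<in> {-1<..<1} \<longrightarrow> \<rho>2 \<in> {-1<..<1} \<longrightarrow>
        ((\<forall>i\<in>{1..z}. positive_definite_mat (bordered_equicorr_mat \<rho>1 \<rho>2 (k i))) \<longleftrightarrow>
         lower_corr_bound \<rho>1 (Max (k ` {1..z})) < \<rho>2 \<and> \<rho>2 < 1))
     \<and>
     (\<forall>(\<rho>1::real) (\<rho>2::real).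
        \<rho>1\<^sup>2 < \<rho>2 \<and> \<rho>2 < 1 \<longrightarrow>
        (\<forall>k::nat. positive_definite_mat (bordered_equicorr_mat \<rho>1 \<rho>2 k)))"
proof (intro conjI allI impI)
  fix z :: nat and k :: "nat \<Rightarrow> nat" and \<rho>1 \<rho>2 :: real
  assume z: "z \<ge> 1" and \<rho>1: "\<rho>1 \<in> {-1<..<1}" and \<rho>2: "\<rho>2 \<in> {-1<..<1}"
  define c where "c n = 1 - \<rho>2 + real n * (\<rho>2 - \<rho>1\<^sup>2)" for n
  define m where "m = Max (k ` {1..z})"
  have m: "m \<in> k ` {1..z}"
    unfolding m_def using z by (intro Max_in) auto
  have le: "k i \<le> m" if "i \<in> {1..z}" for i
    unfolding m_def using that by simp
  \<comment> \<open>With nonnegative slope, \<open>c n\<close> is at least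
    \<open>c 0 = 1 - \<rho>2\<close>; with negative slope, it is at least
    \<open>c m\<close>.\<close>
  have mono: "0 < c n" if "0 < c m" "n \<le> m" for n
  proof (cases "\<rho>2 \<ge> \<rho>1\<^sup>2")
    case True
    then show ?thesis using \<rho>2 by (simp add: c_def add_pos_nonneg)
  next
    case False
    then have "real m * (\<rho>2 - \<rho>1\<^sup>2) \<le> real n * (\<rho>2 - \<rho>1\<^sup>2)"
      using that by (intro mult_right_mono_neg) auto
    then show ?thesis using that by (simp add: c_def)
  qed
  \<comment> \<open>Left to right uses that the maximum \<open>m\<close> is attained by some
    \<open>k i\<close>.\<close>
  have "(\<forall>i\<in>{1..z}. 0 < c (k i)) \<longleftrightarrow> 0 < c m"
    using m mono le by auto
  then show "(\<forall>i\<in>{1..z}. positive_definite_mat (bordered_equicorr_mat \<rho>1 \<rho>2 (k i))) \<longleftrightarrow>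
         lower_corr_bound \<rho>1 (Max (k ` {1..z})) < \<rho>2 \<and> \<rho>2 < 1"
    using \<rho>1 \<rho>2
    by (simp add: positive_definite_bordered_equicorr_iff lower_corr_bound_less_iff c_def m_def)
next
  fix \<rho>1 \<rho>2 :: real and k :: nat
  assume "\<rho>1\<^sup>2 < \<rho>2 \<and> \<rho>2 < 1"
  then show "positive_definite_mat (bordered_equicorr_mat \<rho>1 \<rho>2 k)"
    by (simp add: positive_definite_bordered_equicorr_iff add_pos_nonneg)
qed

end
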